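(* Consider the multiple group random coefficient regression model with one treatment group and one control group ($J=2$). The $E$-optimal weight for the prediction of the individual treatment effects, i.e. the $w\in(0,1)$ minimizing the approximate-design $E$-criterion $\mathrm{E}_{\Psi}(w)$, is $$w^*_{E,\Psi}=\frac{K(2u+v)+2}{K(4u+v)+4}.$$
   Context: Model ($J=2$). Let $N,K,n\ge1$ be integers with $m:=N-n\ge1$, and let $\sigma^2,u,v>0$ be given reals. Individuals $i=1,\dots,n$ form the treatment group and $i=n+1,\dots,N$ the control group. For $k=1,\dots,K$ one observes $Y_{1ik}=\mu_i+\alpha_{1i}+\varepsilon_{1ik}$ for $i\le n$ and $Y_{2ik}=\mu_i+\varepsilon_{2ik}$ for $i>n$. The random variables $\mu_i$, $\alpha_{1i}$ (defined for all $i=1,\dots,N$) and the errors are all pairwise uncorrelated, with $\mathrm{E}(\mu_i)=\mu$, $\mathrm{E}(\alpha_{1i})=\alpha_1$ (unknown), $\mathrm{var}(\mu_i)=u\sigma^2$, $\mathrm{var}(\alpha_{1i})=v\sigma^2$, and errors of mean zero and variance $\sigma^2$. Criterion. Let $\hat\Psi$ be the best linear unbiased predictor of $\Psi=(\alpha_{11},\dots,\alpha_{1N})^\top$. The $E$-criterion of an exact design is the largest eigenvalue of $\mathrm{Cov}(\hat\Psi-\Psi)$. For an approximate design (weight $w=n/N$ for the treatment group and $1-w=m/N$ for the control group, $w$ ranging over all reals in $(0,1)$), it is obtained by substituting $n=Nw$, $m=N(1-w)$, which gives $$\mathrm{E}_{\Psi}(w)=\frac{\sigma^2}{2}\left(\frac{v}{w}+\frac{Ku+1}{Kw(1-w)}+\frac{\sqrt{s_w}}{Kw(1-w)}\right),$$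 where $s_w=K^2(1-w)^2v^2+2K(1-w)(1-2w)(Ku+1)v+(Ku+1)^2$. *)

theory Defs
  imports "HOL-Probability.Probability" "Jordan_Normal_Form.Char_Poly"
begin

definition covar :: "'a measure \<Rightarrow> ('a \<Rightarrow> real) \<Rightarrow> ('a \<Rightarrow> real) \<Rightarrow> real" where
  "covar M X Y =
     (\<integral>\<omega>. (X \<omega> - (\<integral>\<omega>'. X \<omega>' \<partial>M)) * (Y \<omega> - (\<integral>\<omega>'. Y \<omega>' \<partial>M)) \<partial>M)"

definition largest_eigenvalue :: "real mat \<Rightarrow> real" where
  "largest_eigenvalue A = Max {l. eigenvalue A l}"

definition loewner_le :: "nat \<Rightarrow> real mat \<Rightarrow> real mat \<Rightarrow> bool" where
  "loewner_le d A B \<longleftrightarrow>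
     (\<forall>x \<in> carrier_vec d. scalar_prod x (A *\<^sub>v x) \<le> scalar_prod x (B *\<^sub>v x))"

text \<open>
  Labels of the unobservable random variables: \<open>Mean i\<close> is \<open>\<mu>\<^sub>i\<close>, \<open>Effect i\<close> is
  \<open>\<alpha>\<^sub>1\<^sub>i\<close>, and \<open>Error i k\<close> is the error of the \<open>k\<close>-th observation of individual \<open>i\<close>
  (the group is determined by \<open>i\<close>).  Individuals and observations are numbered from 0, so the
  treatment group is \<open>{..<n}\<close> and the control group is \<open>{n..<N}\<close>.
\<close>

datatype rv_label = Mean nat | Effect nat | Error nat nat

definition rv_labels :: "nat \<Rightarrow> nat \<Rightarrow> rv_label set" where
  "rv_labels N K =
     {Mean i | i. i < N} \<union> {Effect i | i. i < N} \<union> {Error i k | i k. i < N \<and> k < K}"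

text \<open>
  The two expectations \<open>\<mu>\<close> and \<open>\<alpha>\<^sub>1\<close> are unknown, so the model is a family of probability
  measures \<open>P \<mu> \<alpha>\<^sub>1\<close>, and unbiasedness is required under every member of the family.
\<close>

locale two_group_rcr =
  fixes P :: "real \<Rightarrow> real \<Rightarrow> 'a measure"
    and Z :: "rv_label \<Rightarrow> 'a \<Rightarrow> real"
    and N n K :: nat
    and \<sigma>2 u v :: real
  assumes sizes: "1 \<le> n" "n < N" "1 \<le> K"
    and params_pos: "0 < \<sigma>2" "0 < u" "0 < v"
    and prob_space_P: "prob_space (P \<mu> \<alpha>)"
    and measurable_Z: "e \<in> rv_labels N K \<Longrightarrow> Z e \<in> borel_measurable (P \<mu> \<alpha>)"
    and square_integrable_Z: "e \<in> rv_labels N K \<Longrightarrow> integrable (P \<mu> \<alpha>) (\<lambda>\<omega>. (Z e \<omega>)\<^sup>2)"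
    and uncorrelated: "\<lbrakk>e \<in> rv_labels N K; e' \<in> rv_labels N K; e \<noteq> e'\<rbrakk>
                         \<Longrightarrow> covar (P \<mu> \<alpha>) (Z e) (Z e') = 0"
    and mean_Mean: "i < N \<Longrightarrow> (\<integral>\<omega>. Z (Mean i) \<omega> \<partial>P \<mu> \<alpha>) = \<mu>"
    and mean_Effect: "i < N \<Longrightarrow> (\<integral>\<omega>. Z (Effect i) \<omega> \<partial>P \<mu> \<alpha>) = \<alpha>"
    and mean_Error: "\<lbrakk>i < N; k < K\<rbrakk> \<Longrightarrow> (\<integral>\<omega>. Z (Error i k) \<omega> \<partial>P \<mu> \<alpha>) = 0"
    and var_Mean: "i < N \<Longrightarrow> covar (P \<mu> \<alpha>) (Z (Mean i)) (Z (Mean i)) = u * \<sigma>2"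
    and var_Effect: "i < N \<Longrightarrow> covar (P \<mu> \<alpha>) (Z (Effect i)) (Z (Effect i)) = v * \<sigma>2"
    and var_Error: "\<lbrakk>i < N; k < K\<rbrakk>
                      \<Longrightarrow> covar (P \<mu> \<alpha>) (Z (Error i k)) (Z (Error i k)) = \<sigma>2"
begin

definition observation :: "nat \<Rightarrow> nat \<Rightarrow> 'a \<Rightarrow> real" where
  "observation i k \<omega> =
     (if i < n then Z (Mean i) \<omega> + Z (Effect i) \<omega> + Z (Error i k) \<omega>
      else Z (Mean i) \<omega> + Z (Error i k) \<omega>)"

text \<open>A linear predictor of the vector of all effects is given by its coefficients: \<open>c i j k\<close> is
  the coefficient of observation \<open>k\<close> of individual \<open>j\<close> in the prediction for individual \<open>i\<close>.\<close>

definition prediction :: "(nat \<Rightarrow> nat \<Rightarrow> nat \<Rightarrow> real) \<Rightarrow> nat \<Rightarrow> 'a \<Rightarrow> real" where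
  "prediction c i \<omega> = (\<Sum>j<N. \<Sum>k<K. c i j k * observation j k \<omega>)"

definition prediction_error :: "(nat \<Rightarrow> nat \<Rightarrow> nat \<Rightarrow> real) \<Rightarrow> nat \<Rightarrow> 'a \<Rightarrow> real" where
  "prediction_error c i \<omega> = prediction c i \<omega> - Z (Effect i) \<omega>"

definition error_cov :: "(nat \<Rightarrow> nat \<Rightarrow> nat \<Rightarrow> real) \<Rightarrow> real \<Rightarrow> real \<Rightarrow> real mat" where
  "error_cov c \<mu> \<alpha> =
     mat N N (\<lambda>(i, j). covar (P \<mu> \<alpha>) (prediction_error c i) (prediction_error c j))"

definition unbiased :: "(nat \<Rightarrow> nat \<Rightarrow> nat \<Rightarrow> real) \<Rightarrow> bool" where
  "unbiased c \<longleftrightarrow> (\<forall>\<mu> \<alpha>. \<forall>i<N. (\<integral>\<omega>. prediction_error c i \<omega> \<partial>P \<mu> \<alpha>) = 0)"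

definition is_BLUP :: "(nat \<Rightarrow> nat \<Rightarrow> nat \<Rightarrow> real) \<Rightarrow> bool" where
  "is_BLUP c \<longleftrightarrow> unbiased c \<and>
     (\<forall>d. unbiased d \<longrightarrow> (\<forall>\<mu> \<alpha>. loewner_le N (error_cov c \<mu> \<alpha>) (error_cov d \<mu> \<alpha>)))"

definition E_criterion_exact :: "real \<Rightarrow> real \<Rightarrow> real" where
  "E_criterion_exact \<mu> \<alpha> = largest_eigenvalue (error_cov (SOME c. is_BLUP c) \<mu> \<alpha>)"

end

definition s_poly :: "nat \<Rightarrow> real \<Rightarrow> real \<Rightarrow> real \<Rightarrow> real" where
  "s_poly K u v w =
     (real K)\<^sup>2 * (1 - w)\<^sup>2 * v\<^sup>2
     + 2 * real K * (1 - w) * (1 - 2 * w) * (real K * u + 1) * v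
     + (real K * u + 1)\<^sup>2"

text \<open>The criterion for approximate designs: the exact criterion written in terms of the group sizes
  \<open>n\<close> and \<open>m = N - n\<close>, with \<open>n = N w\<close> and \<open>m = N (1 - w)\<close> substituted for real \<open>w\<close>
  in the open unit interval.\<close>

definition E_criterion :: "nat \<Rightarrow> real \<Rightarrow> real \<Rightarrow> real \<Rightarrow> real \<Rightarrow> real" where
  "E_criterion K \<sigma>2 u v w =
     \<sigma>2 / 2 * (v / w + (real K * u + 1) / (real K * w * (1 - w))
              + sqrt (s_poly K u v w) / (real K * w * (1 - w)))"

end

theory Submission
  imports Defs "Jordan_Normal_Form.Spectral_Radius"
begin

text \<open>
  Write \<open>a = K u + 1\<close>, \<open>b = K v\<close>, \<open>m = N - n\<close>.  The theorem has two parts, and what links them is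
  that the criterion is the larger zero of a quadratic \<open>t\<^sup>2 - T t + D\<close> with simple coefficients.

  For the exact criterion one needs the best linear unbiased predictor.  The candidate
  \<open>blup_coeff\<close> predicts the effect of a control individual by the difference of the two group means,
  and for a treated individual adds the deviation from the group mean, multiplied by the regression
  coefficient \<open>b / (a + b)\<close>.  Each of its prediction errors has the same covariance with all
  observations of a group, and therefore the same covariance with the errors of any unbiased
  predictor as with its own (\<open>covar_unbiased_error_blup_error\<close>); by Pythagoras the candidate is optimal in the
  Loewner order.  Since that order is antisymmetric on symmetric matrices, every best predictor has
  the same error covariance matrix.  With \<open>p = (1 - b / (a + b)) v \<sigma>2\<close>, \<open>q = v \<sigma>2\<close> and
  \<open>B = \<sigma>2 a N / (K n m)\<close> it is \<open>B J\<close> plus a block diagonal matrix with blocks \<open>p (I - J / n)\<close> and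
  \<open>q (I + J / n)\<close>.  Apart from \<open>p\<close> and \<open>q\<close> it has only the eigenvalues of its two by two
  quotient on block-constant vectors, which has trace \<open>B N + q N / n\<close> and determinant \<open>B q N\<close>; the larger
  eigenvalue of the quotient is the largest of all (\<open>largest_eigenvalue_two_block_mat\<close>).  In terms of
  \<open>w = n / N\<close> this trace and determinant are those of the criterion for approximate designs.

  For the optimal weight (\<open>E_criterion_arg_min\<close>), evaluate the quadratic of weight \<open>w\<close> at the fixed
  number \<open>t0 = \<sigma>2 (4 a + b) / K\<close>.  After multiplication by \<open>w (1 - w) (K / \<sigma>2)\<^sup>2\<close> the value is
  \<open>- ((4 a + b) w - (2 a + b))\<^sup>2\<close>, so the larger zero exceeds \<open>t0\<close> unless
  \<open>w = (2 a + b) / (4 a + b)\<close>, where it equals \<open>t0\<close>.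
\<close>

section \<open>The larger zero of a quadratic\<close>

text \<open>The larger zero of \<open>t\<^sup>2 - T t + D\<close>, provided that the discriminant is nonnegative.  Both the
  largest eigenvalue of the error covariance matrix and the criterion for approximate designs have
  this form, so they can be compared, and the latter can be bounded from below, through the
  coefficients \<open>T\<close> and \<open>D\<close> alone.\<close>

definition larger_root :: "real \<Rightarrow> real \<Rightarrow> real" where
  "larger_root T D = (T + sqrt (T\<^sup>2 - 4 * D)) / 2"

lemma larger_root_is_root:
  assumes "4 * D \<le> T\<^sup>2"
  shows "(larger_root T D)\<^sup>2 - T * larger_root T D + D = 0"
proof -
  have "(sqrt (T\<^sup>2 - 4 * D))\<^sup>2 = T\<^sup>2 - 4 * D"
    using assms by simp
  then show ?thesis
    unfolding larger_root_def by (simp add: field_simps power2_eq_square)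
qed

text \<open>A point where the quadratic is not positive lies between its zeros.  This gives lower bounds for
  the larger zero without any computation of square roots.\<close>

lemma quadratic_nonpos_imp_le_larger_root:
  assumes "t\<^sup>2 - T * t + D \<le> 0"
  shows "t \<le> larger_root T D"
proof -
  have "(2 * t - T)\<^sup>2 \<le> T\<^sup>2 - 4 * D"
    using assms by (simp add: power2_eq_square algebra_simps)
  then have "2 * t - T \<le> sqrt (T\<^sup>2 - 4 * D)"
    by (rule real_le_rsqrt)
  then show ?thesis by (simp add: larger_root_def)
qed

lemma quadratic_neg_imp_less_larger_root:
  assumes "t\<^sup>2 - T * t + D < 0"
  shows "t < larger_root T D"
proof -
  have "(2 * t - T)\<^sup>2 < T\<^sup>2 - 4 * D"
    using assms by (simp add: power2_eq_square algebra_simps)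
  then have "2 * t - T < sqrt (T\<^sup>2 - 4 * D)"
    by (rule real_less_rsqrt)
  then show ?thesis by (simp add: larger_root_def)
qed

section \<open>The criterion for approximate designs and its minimum\<close>

text \<open>The radicand \<open>s_poly\<close> is, up to the factor \<open>(\<sigma>2 / (K w (1 - w)))\<^sup>2\<close>, the discriminant
  of a quadratic whose coefficients are much simpler than the closed formula for the criterion.\<close>

lemma E_criterion_larger_root:
  fixes w :: real
  assumes "1 \<le> K" and "0 < \<sigma>2" and "0 < w" and "w < 1"
  shows "E_criterion K \<sigma>2 u v w =
    larger_root (\<sigma>2 * (v / w + (real K * u + 1) / (real K * w * (1 - w))))
                (\<sigma>2\<^sup>2 * v * (real K * u + 1) / (real K * w * (1 - w)))"
    (is "_ = larger_root ?T ?D")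
proof -
  have pos: "0 < real K" "0 < 1 - w" using assms by auto
  define r where "r = real K * w * (1 - w)"
  have r: "0 < r" using pos assms by (simp add: r_def)
  have T: "?T = \<sigma>2 * (real K * (1 - w) * v + (real K * u + 1)) / r"
    using pos assms by (simp add: r_def field_simps)
  have D: "4 * ?D = \<sigma>2\<^sup>2 * (4 * v * (real K * u + 1) * r) / r\<^sup>2"
    using r by (simp add: r_def[symmetric] power2_eq_square)
  have "?T\<^sup>2 - 4 * ?D = \<sigma>2\<^sup>2 * s_poly K u v w / r\<^sup>2"
    unfolding T D power_divide power_mult_distrib diff_divide_distrib[symmetric]
      right_diff_distrib[symmetric]
    by (simp add: s_poly_def r_def power2_eq_square algebra_simps)
  then have sqrt_disc: "sqrt (?T\<^sup>2 - 4 * ?D) = \<sigma>2 * sqrt (s_poly K u v w) / r"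
    using r assms by (simp add: real_sqrt_divide real_sqrt_mult)
  show ?thesis
    unfolding E_criterion_def larger_root_def sqrt_disc
    by (simp add: r_def[symmetric] distrib_left add_divide_distrib)
qed

text \<open>Write \<open>a = K u + 1\<close> and \<open>b = K v\<close>.  Multiplied by \<open>w (1 - w)\<close>, the quadratic of the criterion at
  weight \<open>w\<close> and at a fixed argument \<open>t\<close> is itself quadratic in \<open>w\<close>.  It is concave with a double zero
  for \<open>t = t0 = \<sigma>2 (4 a + b) / K\<close>, where it is a negative multiple of
  \<open>((4 a + b) w - (2 a + b))\<^sup>2\<close>.  Hence \<open>t0\<close> lies strictly below the larger root unless this square
  vanishes, which happens only at \<open>w0 = (2 a + b) / (4 a + b)\<close>; there the criterion takes the value
  \<open>t0\<close>.\<close>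

lemma E_criterion_arg_min:
  fixes K :: nat and \<sigma>2 u v :: real
  assumes "1 \<le> K" and "0 < \<sigma>2" and "0 < u" and "0 < v"
  shows "is_arg_min (E_criterion K \<sigma>2 u v) (\<lambda>w. w \<in> {0<..<1}) w
    \<longleftrightarrow> w = (real K * (2 * u + v) + 2) / (real K * (4 * u + v) + 4)"
proof -
  define a where "a = real K * u + 1"
  define b where "b = real K * v"
  define w0 where "w0 = (2 * a + b) / (4 * a + b)"
  define t0 where "t0 = \<sigma>2 / real K * (4 * a + b)"
  let ?T = "\<lambda>w. \<sigma>2 * (v / w + (real K * u + 1) / (real K * w * (1 - w)))"
  let ?D = "\<lambda>w. \<sigma>2\<^sup>2 * v * (real K * u + 1) / (real K * w * (1 - w))"
  have K: "0 < real K" using assms by simp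
  have ab: "0 < a" "0 < b" using assms K by (auto simp: a_def b_def add_pos_pos)
  have w0: "0 < w0" "w0 < 1" using ab by (auto simp: w0_def field_simps)
  have square: "t0\<^sup>2 - ?T w * t0 + ?D w
      = - (\<sigma>2 / real K)\<^sup>2 * ((4 * a + b) * w - (2 * a + b))\<^sup>2 / (w * (1 - w))"
    if "0 < w" "w < 1" for w
  proof -
    have nz: "w \<noteq> 0" "1 - w \<noteq> 0" using that by auto
    have v: "v = b / real K" using K by (simp add: b_def)
    have T: "?T w = \<sigma>2 / real K * ((b * (1 - w) + a) / (w * (1 - w)))"
      unfolding v a_def[symmetric] using nz K by (simp add: divide_simps)
    have D: "?D w = (\<sigma>2 / real K)\<^sup>2 * (a * b / (w * (1 - w)))"
      unfolding v a_def[symmetric] using nz K by (simp add: divide_simps power2_eq_square)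
    have "t0\<^sup>2 - ?T w * t0 + ?D w = (\<sigma>2 / real K)\<^sup>2 *
      ((4*a+b)\<^sup>2 - (b * (1 - w) + a) / (w * (1 - w)) * (4*a+b) + a * b / (w * (1 - w)))"
    proof -
      have "(c * L)\<^sup>2 - c * p * (c * L) + c\<^sup>2 * q = c\<^sup>2 * (L\<^sup>2 - p * L + q)" for c L p q :: real
        by (simp add: power2_eq_square algebra_simps)
      then show ?thesis unfolding T D t0_def .
    qed
    also have "(4*a+b)\<^sup>2 - (b * (1 - w) + a) / (w * (1 - w)) * (4*a+b) + a * b / (w * (1 - w))
      = ((4*a+b)\<^sup>2 * (w * (1 - w)) - (b * (1 - w) + a) * (4*a+b) + a * b) / (w * (1 - w))"
    proof -
      have "L - p / r * M + q / r = (L * r - p * M + q) / r" if "r \<noteq> 0" for L p q r M :: real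
        using that by (simp add: field_simps)
      then show ?thesis using nz by simp
    qed
    also have "(4*a+b)\<^sup>2 * (w * (1 - w)) - (b * (1 - w) + a) * (4*a+b) + a * b
      = - ((4 * a + b) * w - (2 * a + b))\<^sup>2"
      by (simp add: power2_eq_square algebra_simps)
    finally show ?thesis by simp
  qed
  have less: "t0 < E_criterion K \<sigma>2 u v w" if "0 < w" "w < 1" "w \<noteq> w0" for w
  proof -
    have "(4 * a + b) * w - (2 * a + b) \<noteq> 0"
      using that(3) ab by (simp add: w0_def field_simps)
    then have "0 < (\<sigma>2 / real K)\<^sup>2 * ((4 * a + b) * w - (2 * a + b))\<^sup>2 / (w * (1 - w))"
      using that K assms by simp
    then have "t0\<^sup>2 - ?T w * t0 + ?D w < 0"
      using square[OF that(1,2)] by simp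
    then show ?thesis
      unfolding E_criterion_larger_root[OF assms(1,2) that(1,2)]
      by (rule quadratic_neg_imp_less_larger_root)
  qed
  \<comment> \<open>At the optimum the radicand is a perfect square: its first two summands cancel.\<close>
  have s: "s_poly K u v w0 = a\<^sup>2"
  proof -
    have "1 - w0 = 2 * a / (4 * a + b)" "1 - 2 * w0 = - b / (4 * a + b)"
      using ab by (auto simp: w0_def field_simps)
    moreover have "s_poly K u v w0 = b\<^sup>2 * (1 - w0)\<^sup>2 + 2 * b * (1 - w0) * (1 - 2 * w0) * a + a\<^sup>2"
      unfolding s_poly_def a_def[symmetric] by (simp add: b_def power_mult_distrib)
    ultimately show ?thesis
      by (simp add: power_divide power_mult_distrib power2_eq_square)
  qed
  have value_at_w0: "E_criterion K \<sigma>2 u v w0 = t0"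
  proof -
    have "1 - w0 = 2 * a / (4 * a + b)" using ab by (auto simp: w0_def field_simps)
    then have halves: "a / (real K * w0 * (1 - w0)) = (4*a+b)\<^sup>2 / (real K * (2*a+b)) / 2"
      using ab by (simp add: w0_def power2_eq_square)
    have effect: "v / w0 = b / real K * ((4*a+b) / (2*a+b))"
      using K by (simp add: b_def w0_def)
    have root: "sqrt (a\<^sup>2) = a" using ab by simp
    have "E_criterion K \<sigma>2 u v w0 = \<sigma>2 / 2 * (b / real K * ((4*a+b)/(2*a+b))
         + (4*a+b)\<^sup>2 / (real K * (2*a+b)))"
      unfolding E_criterion_def s a_def[symmetric] root halves effect
      by (simp only: add.assoc field_sum_of_halves)
    also have "\<dots> = t0"
    proof -
      have identity: "c / 2 * (b / k * (e / d) + e\<^sup>2 / (k * d)) = c / k * e"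
        if "0 < k" "0 < d" "b + e = 2 * d" for c b k e d :: real
      proof -
        have "c / 2 * (b / k * (e / d) + e\<^sup>2 / (k * d)) = c / 2 * (e * (b + e) / (k * d))"
          using that(1,2) by (simp add: field_simps power2_eq_square)
        also have "\<dots> = c / k * e" unfolding that(3) using that(1,2) by simp
        finally show ?thesis .
      qed
      show ?thesis unfolding t0_def by (rule identity) (use ab K in auto)
    qed
    finally show ?thesis .
  qed
  have "is_arg_min (E_criterion K \<sigma>2 u v) (\<lambda>w. w \<in> {0<..<1}) w \<longleftrightarrow> w = w0"
    unfolding is_arg_min_def using less w0 value_at_w0
    by (metis greaterThanLessThan_iff less_irrefl order_less_asym)
  also have "w0 = (real K * (2 * u + v) + 2) / (real K * (4 * u + v) + 4)"
    by (simp add: w0_def a_def b_def algebra_simps)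
  finally show ?thesis .
qed

section \<open>The spectrum of a two-block matrix\<close>

lemma sum_lessThan_split:
  fixes f :: "nat \<Rightarrow> 'b::comm_monoid_add"
  assumes "n \<le> N"
  shows "(\<Sum>j<N. f j) = (\<Sum>j<n. f j) + (\<Sum>j\<in>{n..<N}. f j)"
  using assms by (metis sum.atLeastLessThan_concat lessThan_atLeast0 zero_le)

text \<open>In blocks of sizes \<open>n\<close> and \<open>N - n\<close>, with \<open>J\<close> for all-ones matrices of any size: \<open>B J\<close> plus the
  block diagonal matrix with blocks \<open>p (I - J / n)\<close> and \<open>q (I + J / n)\<close>.  The error covariance
  matrix of the best linear unbiased predictor has this shape, the blocks being the treatment and
  the control group.\<close>

definition two_block_mat :: "nat \<Rightarrow> nat \<Rightarrow> real \<Rightarrow> real \<Rightarrow> real \<Rightarrow> real mat" where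
  "two_block_mat N n p q B = mat N N (\<lambda>(i, j).
     B + (if i < n \<and> j < n then p * ((if i = j then 1 else 0) - 1 / real n)
          else if n \<le> i \<and> n \<le> j then q * ((if i = j then 1 else 0) + 1 / real n)
          else 0))"

lemma two_block_mat_mult_vec:
  assumes "0 < n" and "n < N" and "x \<in> carrier_vec N" and "i < N"
  defines "S \<equiv> \<Sum>j<n. vec_index x j" and "R \<equiv> \<Sum>j\<in>{n..<N}. vec_index x j"
  shows "vec_index (two_block_mat N n p q B *\<^sub>v x) i =
    B * (S + R) + (if i < n then p * (vec_index x i - S / real n)
                   else q * (vec_index x i + R / real n))"
proof -
  have "vec_index (two_block_mat N n p q B *\<^sub>v x) i
      = (\<Sum>j<N. two_block_mat N n p q B $$ (i, j) * vec_index x j)"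
    using assms by (simp add: two_block_mat_def scalar_prod_def lessThan_atLeast0)
  also have "\<dots> = (\<Sum>j<n. two_block_mat N n p q B $$ (i, j) * vec_index x j)
      + (\<Sum>j\<in>{n..<N}. two_block_mat N n p q B $$ (i, j) * vec_index x j)"
    using assms by (intro sum_lessThan_split) simp
  also have "\<dots> = B * (S + R) + (if i < n then p * (vec_index x i - S / real n)
                   else q * (vec_index x i + R / real n))"
  proof (cases "i < n")
    case True
    have "(\<Sum>j<n. two_block_mat N n p q B $$ (i, j) * vec_index x j)
        = (\<Sum>j<n. B * vec_index x j + p * (if i = j then vec_index x j else 0)
             - p / real n * vec_index x j)"
      using assms True
      by (intro sum.cong) (auto simp: two_block_mat_def algebra_simps)
    also have "\<dots> = B * S + p * vec_index x i - p / real n * S"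
      unfolding sum_subtractf sum.distrib sum_distrib_left[symmetric] S_def using True by simp
    finally have 1: "(\<Sum>j<n. two_block_mat N n p q B $$ (i, j) * vec_index x j)
        = B * S + p * vec_index x i - p / real n * S" .
    have 2: "(\<Sum>j\<in>{n..<N}. two_block_mat N n p q B $$ (i, j) * vec_index x j) = B * R"
      unfolding R_def sum_distrib_left using assms True
      by (intro sum.cong) (auto simp: two_block_mat_def)
    show ?thesis unfolding 1 2 using True by (simp add: algebra_simps)
  next
    case False
    have "(\<Sum>j\<in>{n..<N}. two_block_mat N n p q B $$ (i, j) * vec_index x j)
        = (\<Sum>j\<in>{n..<N}. B * vec_index x j + q * (if i = j then vec_index x j else 0)
             + q / real n * vec_index x j)"
      using assms False
      by (intro sum.cong) (auto simp: two_block_mat_def algebra_simps)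
    also have "\<dots> = B * R + q * vec_index x i + q / real n * R"
      unfolding sum.distrib sum_distrib_left[symmetric] R_def using False assms(4) by simp
    finally have 1: "(\<Sum>j\<in>{n..<N}. two_block_mat N n p q B $$ (i, j) * vec_index x j)
        = B * R + q * vec_index x i + q / real n * R" .
    have 2: "(\<Sum>j<n. two_block_mat N n p q B $$ (i, j) * vec_index x j) = B * S"
      unfolding S_def sum_distrib_left using assms False
      by (intro sum.cong) (auto simp: two_block_mat_def)
    show ?thesis unfolding 1 2 using False by (simp add: algebra_simps)
  qed
  finally show ?thesis .
qed

lemma largest_eigenvalue_eqI:
  assumes "A \<in> carrier_mat N N" and "eigenvalue A l"
    and "\<And>k. eigenvalue A k \<Longrightarrow> k \<le> l"
  shows "largest_eigenvalue A = l"
proof -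
  have "finite {k. eigenvalue A k}"
    using card_finite_spectrum(1)[OF assms(1)] by (simp add: spectrum_def)
  then show ?thesis
    unfolding largest_eigenvalue_def using assms by (intro Max_eqI) auto
qed

text \<open>On vectors whose two block sums \<open>S\<close> and \<open>R\<close> vanish, the matrix multiplies the entries of
  the first block by \<open>p\<close> and those of the second by \<open>q\<close>.  For any other eigenvector, \<open>(S, R)\<close> is
  an eigenvector of a two by two matrix with trace \<open>B N + q N / n\<close> and determinant \<open>B q N\<close>.\<close>

lemma two_block_mat_eigenvalue_cases:
  assumes nN: "0 < n" "n < N" and "eigenvalue (two_block_mat N n p q B) l"
  shows "l = p \<or> l = q \<or>
    l\<^sup>2 - (B * real N + q * real N / real n) * l + B * q * real N = 0"
proof -
  let ?M = "two_block_mat N n p q B"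
  have dim: "dim_row ?M = N" by (simp add: two_block_mat_def)
  obtain x where x: "x \<in> carrier_vec N" "x \<noteq> 0\<^sub>v N" "?M *\<^sub>v x = l \<cdot>\<^sub>v x"
    using assms(3) unfolding eigenvalue_def eigenvector_def dim by blast
  define S where "S = (\<Sum>j<n. vec_index x j)"
  define R where "R = (\<Sum>j\<in>{n..<N}. vec_index x j)"
  have row: "l * vec_index x i = B * (S + R) + (if i < n then p * (vec_index x i - S / real n)
                   else q * (vec_index x i + R / real n))" if "i < N" for i
    using two_block_mat_mult_vec[OF nN x(1) that, of p q B] x(1,3) that
    by (simp add: S_def R_def)
  have "l * S = (\<Sum>i<n. B * (S + R) + p * (vec_index x i - S / real n))"
    unfolding S_def sum_distrib_left using row nN by (intro sum.cong) (auto simp: S_def)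
  also have "\<dots> = B * real n * (S + R)"
    using nN by (simp add: sum.distrib sum_subtractf right_diff_distrib
        flip: sum_distrib_left S_def)
  finally have eqS: "l * S = B * real n * (S + R)" .
  have "l * R = (\<Sum>i\<in>{n..<N}. B * (S + R) + q * (vec_index x i + R / real n))"
    unfolding R_def sum_distrib_left using row nN by (intro sum.cong) (auto simp: R_def)
  also have "\<dots> = B * (real N - real n) * (S + R) + q * R + q * R * (real N - real n) / real n"
    using nN by (simp add: sum.distrib distrib_left of_nat_diff flip: sum_distrib_left R_def)
  also have "\<dots> = B * (real N - real n) * (S + R) + q * real N / real n * R"
    using nN by (simp add: field_simps)
  finally have eqR: "l * R = B * (real N - real n) * (S + R) + q * real N / real n * R" .
  show ?thesis
  proof (cases "S = 0 \<and> R = 0")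
    case True
    obtain i where i: "i < N" "vec_index x i \<noteq> 0"
      using x(1,2) by (metis carrier_vecD eq_vecI index_zero_vec)
    then show ?thesis using row[OF i(1)] True by (auto split: if_splits)
  next
    case False
    define t where "t = q * real N / real n"
    have tn: "t * real n = q * real N" using nN by (simp add: t_def)
    \<comment> \<open>Cayley--Hamilton for the two by two system satisfied by \<open>S\<close> and \<open>R\<close>, written with its residuals.\<close>
    define e1 where "e1 = l * S - B * real n * (S + R)"
    define e2 where "e2 = l * R - (B * (real N - real n) * (S + R) + t * R)"
    have e: "e1 = 0" "e2 = 0" using eqS eqR by (simp_all add: e1_def e2_def t_def)
    have "(l\<^sup>2 - (B * real N + t) * l + B * (t * real n)) * S
        = (l - B * (real N - real n) - t) * e1 + B * real n * e2"
      unfolding e1_def e2_def by (simp add: power2_eq_square algebra_simps)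
    moreover have "(l\<^sup>2 - (B * real N + t) * l + B * (t * real n)) * R
        = (l - B * real n) * e2 + B * (real N - real n) * e1"
      unfolding e1_def e2_def by (simp add: power2_eq_square algebra_simps)
    ultimately have "l\<^sup>2 - (B * real N + t) * l + B * (t * real n) = 0"
      using False e by auto
    then show ?thesis unfolding tn by (simp add: t_def mult.assoc)
  qed
qed

text \<open>Of the candidates for eigenvalues, \<open>q\<close> dominates \<open>p\<close>, and the quadratic is negative at \<open>q\<close>
  because its value there is \<open>q\<^sup>2 (1 - N / n)\<close>; so its larger zero beats both.  That this zero is
  an eigenvalue is seen from a vector that is constant on each block.\<close>

lemma largest_eigenvalue_two_block_mat:
  assumes nN: "0 < n" "n < N" and "p \<le> q" and "0 < q" and "0 < B"
  shows "largest_eigenvalue (two_block_mat N n p q B) =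
    larger_root (B * real N + q * real N / real n) (B * q * real N)" (is "_ = larger_root ?T ?D")
proof (rule largest_eigenvalue_eqI)
  let ?M = "two_block_mat N n p q B"
  define l where "l = larger_root ?T ?D"
  show carrier: "?M \<in> carrier_mat N N" by (simp add: two_block_mat_def)
  have "q\<^sup>2 - ?T * q + ?D = q\<^sup>2 * (1 - real N / real n)"
    by (simp add: power2_eq_square algebra_simps)
  also have "\<dots> < 0" using nN assms by (simp add: mult_less_0_iff)
  finally have q_neg: "q\<^sup>2 - ?T * q + ?D < 0" .
  have q_less: "q < l"
    unfolding l_def by (rule quadratic_neg_imp_less_larger_root[OF q_neg])
  have "?T\<^sup>2 - 4 * ?D = (2 * q - ?T)\<^sup>2 - 4 * (q\<^sup>2 - ?T * q + ?D)"
    by (simp add: power2_eq_square algebra_simps)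
  then have root: "l\<^sup>2 - ?T * l + ?D = 0"
    unfolding l_def using q_neg by (intro larger_root_is_root) (smt (verit) zero_le_power2)
  show "k \<le> larger_root ?T ?D" if "eigenvalue ?M k" for k
    using two_block_mat_eigenvalue_cases[OF nN that] q_less \<open>p \<le> q\<close>
      quadratic_nonpos_imp_le_larger_root[of k ?T ?D]
    unfolding l_def by auto
  \<comment> \<open>The block sums of this vector are \<open>B n\<close> and \<open>l - B n\<close>, so the eigenvalue equation on the first block is immediate.\<close>
  define x where "x = vec N (\<lambda>i. if i < n then B else (l - B * real n) / (real N - real n))"
  have sums: "(\<Sum>j<n. vec_index x j) = B * real n" "(\<Sum>j\<in>{n..<N}. vec_index x j) = l - B * real n"
    using nN by (auto simp: x_def of_nat_diff)
  have "?M *\<^sub>v x = l \<cdot>\<^sub>v x"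
  proof (rule eq_vecI)
    fix i assume "i < dim_vec (l \<cdot>\<^sub>v x)"
    then have i: "i < N" by (simp add: x_def)
    have xc: "x \<in> carrier_vec N" by (simp add: x_def)
    define d where "d = real N - real n"
    define y where "y = l - B * real n"
    have d: "0 < d" and N: "real N = d + real n" using nN by (auto simp: d_def)
    have "l * y = B * l * d + q * y * (1 + d / real n)"
      using root nN unfolding N y_def by (simp add: field_simps power2_eq_square)
    then have "l * (y / d) = (B * l * d + q * y * (1 + d / real n)) / d"
      by simp
    also have "\<dots> = B * l + q * (y / d + y / real n)"
      using d nN by (simp add: field_simps)
    finally have "B * l + q * (y / d + y / real n) = l * (y / d)" ..
    then show "vec_index (?M *\<^sub>v x) i = vec_index (l \<cdot>\<^sub>v x) i"
      using i nN unfolding two_block_mat_mult_vec[OF nN xc i] sums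
      by (simp add: x_def y_def d_def)
  qed (simp add: x_def two_block_mat_def)
  moreover have "x \<noteq> 0\<^sub>v N"
  proof
    assume "x = 0\<^sub>v N"
    then have "vec_index x 0 = 0" using nN by simp
    then show False using nN \<open>0 < B\<close> by (simp add: x_def)
  qed
  ultimately show "eigenvalue ?M (larger_root ?T ?D)"
    unfolding eigenvalue_def eigenvector_def l_def[symmetric]
    by (intro exI[of _ x]) (auto simp: x_def two_block_mat_def)
qed

section \<open>Quadratic forms and the Loewner order\<close>

lemma mat_quadratic_form:
  fixes f :: "nat \<times> nat \<Rightarrow> real"
  assumes "x \<in> carrier_vec N"
  shows "scalar_prod x (mat N N f *\<^sub>v x)
    = (\<Sum>i<N. vec_index x i * (\<Sum>j<N. vec_index x j * f (i, j)))"
  using assms by (simp add: scalar_prod_def lessThan_atLeast0 mult.commute[of "f _"])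

text \<open>A symmetric matrix is determined by its quadratic form, through polarisation on sums of two unit
  vectors.  Consequently all best predictors have the same error covariance matrix, and an
  arbitrary choice among them does no harm.\<close>

lemma loewner_le_antisym:
  assumes A: "A \<in> carrier_mat N N" "\<And>i j. i < N \<Longrightarrow> j < N \<Longrightarrow> A $$ (i, j) = A $$ (j, i)"
    and B: "B \<in> carrier_mat N N" "\<And>i j. i < N \<Longrightarrow> j < N \<Longrightarrow> B $$ (i, j) = B $$ (j, i)"
    and "loewner_le N A B" and "loewner_le N B A"
  shows "A = B"
proof (rule eq_matI)
  fix i j assume "i < dim_row B" "j < dim_col B"
  then have ij: "i < N" "j < N" using B by auto
  have form: "scalar_prod x (A *\<^sub>v x) = scalar_prod x (B *\<^sub>v x)" if "x \<in> carrier_vec N" for x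
    using assms(5,6) that by (auto simp: loewner_le_def intro: antisym)
  have unit: "scalar_prod (unit_vec N a) (C *\<^sub>v unit_vec N b) = C $$ (a, b)"
    if "C \<in> carrier_mat N N" "a < N" "b < N" for C :: "real mat" and a b
    using that by (simp add: scalar_prod_right_unit)
  have polar: "scalar_prod (unit_vec N i + unit_vec N j) (C *\<^sub>v (unit_vec N i + unit_vec N j))
      = C $$ (i, i) + C $$ (j, j) + C $$ (i, j) + C $$ (j, i)"
    if C: "C \<in> carrier_mat N N" for C :: "real mat"
  proof -
    have c: "C *\<^sub>v unit_vec N i \<in> carrier_vec N" "C *\<^sub>v unit_vec N j \<in> carrier_vec N"
      using C by auto
    show ?thesis
      using C c unit[OF C] ij
      by (simp add: mult_add_distrib_mat_vec[of _ N N] scalar_prod_add_distrib[of _ N]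
          add_scalar_prod_distrib[of _ N])
  qed
  have diag: "A $$ (a, a) = B $$ (a, a)" if "a < N" for a
    using form[of "unit_vec N a"] unfolding unit[OF A(1) that that] unit[OF B(1) that that] by simp
  have "scalar_prod (unit_vec N i + unit_vec N j) (A *\<^sub>v (unit_vec N i + unit_vec N j))
      = scalar_prod (unit_vec N i + unit_vec N j) (B *\<^sub>v (unit_vec N i + unit_vec N j))"
    by (rule form) simp
  then show "A $$ (i, j) = B $$ (i, j)"
    unfolding polar[OF A(1)] polar[OF B(1)] diag[OF ij(1)] diag[OF ij(2)]
      A(2)[OF ij(2,1)] B(2)[OF ij(2,1)] by linarith
qed (use A B in auto)

section \<open>Covariances of square integrable random variables\<close>

definition square_integrable :: "'a measure \<Rightarrow> ('a \<Rightarrow> real) \<Rightarrow> bool" where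
  "square_integrable M X \<longleftrightarrow>
     X \<in> borel_measurable M \<and> integrable M (\<lambda>\<omega>. (X \<omega>)\<^sup>2)"

lemma square_integrable_mult_integrable:
  assumes "square_integrable M X" and "square_integrable M Y"
  shows "integrable M (\<lambda>\<omega>. X \<omega> * Y \<omega>)"
proof (rule Bochner_Integration.integrable_bound)
  show "integrable M (\<lambda>\<omega>. (X \<omega>)\<^sup>2 + (Y \<omega>)\<^sup>2)"
    using assms by (auto simp: square_integrable_def)
  show "(\<lambda>\<omega>. X \<omega> * Y \<omega>) \<in> borel_measurable M"
    using assms by (auto simp: square_integrable_def)
  have "\<bar>x * y\<bar> \<le> x\<^sup>2 + y\<^sup>2" for x y :: real
    using sum_squares_bound[of "\<bar>x\<bar>" "\<bar>y\<bar>"] abs_ge_zero[of "x * y"]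
    unfolding abs_mult power2_abs by linarith
  then show "AE \<omega> in M. norm (X \<omega> * Y \<omega>) \<le> norm ((X \<omega>)\<^sup>2 + (Y \<omega>)\<^sup>2)"
    by simp
qed

lemma square_integrable_add [intro]:
  assumes "square_integrable M X" and "square_integrable M Y"
  shows "square_integrable M (\<lambda>\<omega>. X \<omega> + Y \<omega>)"
proof -
  have "integrable M (\<lambda>\<omega>. (X \<omega>)\<^sup>2 + (Y \<omega>)\<^sup>2 + 2 * (X \<omega> * Y \<omega>))"
    using assms square_integrable_mult_integrable[OF assms]
    by (auto simp: square_integrable_def)
  then show ?thesis
    using assms by (auto simp: square_integrable_def power2_sum mult.assoc)
qed

lemma square_integrable_cmult [intro]:
  "square_integrable M X \<Longrightarrow> square_integrable M (\<lambda>\<omega>. c * X \<omega>)"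
  by (auto simp: square_integrable_def power_mult_distrib)

lemma square_integrable_diff [intro]:
  assumes "square_integrable M X" and "square_integrable M Y"
  shows "square_integrable M (\<lambda>\<omega>. X \<omega> - Y \<omega>)"
  using square_integrable_add[OF assms(1) square_integrable_cmult[OF assms(2), of "-1"]] by simp

lemma square_integrable_sum [intro]:
  assumes "\<And>i. i \<in> I \<Longrightarrow> square_integrable M (X i)"
  shows "square_integrable M (\<lambda>\<omega>. \<Sum>i\<in>I. X i \<omega>)"
  using assms
proof (induction I rule: infinite_finite_induct)
  case (insert i I)
  then show ?case by (auto intro!: square_integrable_add)
qed (auto simp: square_integrable_def)

lemma covar_commute: "covar M X Y = covar M Y X"
  by (simp add: covar_def mult.commute)

lemma covar_self_nonneg: "0 \<le> covar M X X"
  by (simp add: covar_def)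

context prob_space
begin

lemma square_integrable_integrable: "square_integrable M X \<Longrightarrow> integrable M X"
  unfolding square_integrable_def by (auto intro: square_integrable_imp_integrable)

lemma covar_eq_expectation:
  assumes "square_integrable M X" and "square_integrable M Y"
  shows "covar M X Y = expectation (\<lambda>\<omega>. X \<omega> * Y \<omega>) - expectation X * expectation Y"
  using square_integrable_integrable[OF assms(1)] square_integrable_integrable[OF assms(2)]
    square_integrable_mult_integrable[OF assms]
  by (simp add: covar_def algebra_simps prob_space)

lemma covar_add_left:
  assumes "square_integrable M X" and "square_integrable M X'" and "square_integrable M Y"
  shows "covar M (\<lambda>\<omega>. X \<omega> + X' \<omega>) Y = covar M X Y + covar M X' Y"
  using assms square_integrable_integrable[OF assms(1)] square_integrable_integrable[OF assms(2)]
    square_integrable_mult_integrable[OF assms(1,3)]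
    square_integrable_mult_integrable[OF assms(2,3)]
  by (simp add: covar_eq_expectation square_integrable_add distrib_right)

lemma covar_cmult_left:
  assumes "square_integrable M X" and "square_integrable M Y"
  shows "covar M (\<lambda>\<omega>. c * X \<omega>) Y = c * covar M X Y"
  using assms
  by (simp add: covar_eq_expectation square_integrable_cmult mult.assoc right_diff_distrib)

lemma covar_diff_left:
  assumes "square_integrable M X" and "square_integrable M X'" and "square_integrable M Y"
  shows "covar M (\<lambda>\<omega>. X \<omega> - X' \<omega>) Y = covar M X Y - covar M X' Y"
  using assms square_integrable_integrable[OF assms(1)] square_integrable_integrable[OF assms(2)]
    square_integrable_mult_integrable[OF assms(1,3)]
    square_integrable_mult_integrable[OF assms(2,3)]
  by (simp add: covar_eq_expectation square_integrable_diff left_diff_distrib)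

lemma covar_sum_left:
  assumes "\<And>i. i \<in> I \<Longrightarrow> square_integrable M (X i)" and "square_integrable M Y"
  shows "covar M (\<lambda>\<omega>. \<Sum>i\<in>I. X i \<omega>) Y = (\<Sum>i\<in>I. covar M (X i) Y)"
  using assms(1)
proof (induction I rule: infinite_finite_induct)
  case (insert i I)
  then show ?case
    using assms(2) by (simp add: covar_add_left square_integrable_sum)
qed (simp_all add: covar_def)

text \<open>Pythagoras: the hypothesis says that \<open>X - Y\<close> is uncorrelated with \<open>Y\<close>, hence the variance of \<open>X\<close>
  is that of \<open>Y\<close> plus that of \<open>X - Y\<close>.  This is how a best predictor is recognised.\<close>

lemma covar_le_of_uncorrelated_difference:
  assumes X: "square_integrable M X" and Y: "square_integrable M Y"
    and "covar M X Y = covar M Y Y"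
  shows "covar M Y Y \<le> covar M X X"
proof -
  let ?D = "\<lambda>\<omega>. X \<omega> - Y \<omega>"
  have D: "square_integrable M ?D" using X Y by auto
  have "covar M ?D Y = 0" using covar_diff_left[OF X Y Y] assms(3) by simp
  moreover have "covar M ?D X = covar M X X - covar M Y X"
    by (rule covar_diff_left[OF X Y X])
  moreover have "covar M ?D ?D = covar M ?D X - covar M ?D Y"
    using covar_diff_left[OF X Y D]
    unfolding covar_commute[of M X ?D] covar_commute[of M Y ?D] .
  ultimately have "covar M ?D ?D = covar M X X - covar M Y Y"
    using assms(3) covar_commute[of M X Y] by simp
  then show ?thesis using covar_self_nonneg[of M ?D] by simp
qed

lemma covar_linear_combinations:
  assumes "\<And>i. i < N \<Longrightarrow> square_integrable M (X i)" and "\<And>i. i < N \<Longrightarrow> square_integrable M (Y i)"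
  shows "covar M (\<lambda>\<omega>. \<Sum>i<N. a i * X i \<omega>) (\<lambda>\<omega>. \<Sum>j<N. a j * Y j \<omega>)
    = (\<Sum>i<N. a i * (\<Sum>j<N. a j * covar M (X i) (Y j)))"
proof -
  let ?Y = "\<lambda>\<omega>. \<Sum>j<N. a j * Y j \<omega>"
  have Y: "square_integrable M ?Y" using assms by (intro square_integrable_sum) auto
  have "covar M (X i) ?Y = (\<Sum>j<N. a j * covar M (X i) (Y j))" if "i < N" for i
  proof -
    have "covar M ?Y (X i) = (\<Sum>j<N. covar M (\<lambda>\<omega>. a j * Y j \<omega>) (X i))"
      using assms that by (intro covar_sum_left) auto
    also have "\<dots> = (\<Sum>j<N. a j * covar M (X i) (Y j))"
      using assms that by (intro sum.cong) (auto simp: covar_cmult_left covar_commute[of M "X i"])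
    finally show ?thesis by (simp add: covar_commute[of M "X i"])
  qed
  moreover have "covar M (\<lambda>\<omega>. \<Sum>i<N. a i * X i \<omega>) ?Y
      = (\<Sum>i<N. covar M (\<lambda>\<omega>. a i * X i \<omega>) ?Y)"
    using assms Y by (intro covar_sum_left) auto
  moreover have "\<dots> = (\<Sum>i<N. a i * covar M (X i) ?Y)"
    using assms Y by (intro sum.cong) (auto simp: covar_cmult_left)
  ultimately show ?thesis by simp
qed

end

section \<open>Covariances in the two-group model\<close>

context two_group_rcr
begin

abbreviation treated :: "nat \<Rightarrow> real" where
  "treated i \<equiv> of_bool (i < n)"

lemma rv_labels_iff [simp]:
  "Mean i \<in> rv_labels N K \<longleftrightarrow> i < N"
  "Effect i \<in> rv_labels N K \<longleftrightarrow> i < N"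
  "Error i k \<in> rv_labels N K \<longleftrightarrow> i < N \<and> k < K"
  by (auto simp: rv_labels_def)

lemma square_integrable_rv:
  "e \<in> rv_labels N K \<Longrightarrow> square_integrable (P \<mu> \<alpha>) (Z e)"
  using measurable_Z square_integrable_Z by (simp add: square_integrable_def)

lemma observation_alt:
  "observation i k = (\<lambda>\<omega>. Z (Mean i) \<omega> + Z (Error i k) \<omega> + treated i * Z (Effect i) \<omega>)"
  by (auto simp: observation_def fun_eq_iff)

lemma square_integrable_observation:
  "i < N \<Longrightarrow> k < K \<Longrightarrow> square_integrable (P \<mu> \<alpha>) (observation i k)"
  unfolding observation_alt
  by (intro square_integrable_add square_integrable_cmult square_integrable_rv) auto

lemma square_integrable_prediction:
  "square_integrable (P \<mu> \<alpha>) (prediction c i)"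
  unfolding prediction_def[abs_def]
  by (intro square_integrable_sum square_integrable_cmult square_integrable_observation) auto

lemma square_integrable_prediction_error:
  "i < N \<Longrightarrow> square_integrable (P \<mu> \<alpha>) (prediction_error c i)"
  unfolding prediction_error_def[abs_def]
  by (intro square_integrable_diff square_integrable_prediction square_integrable_rv) auto

lemma covar_observation_left:
  assumes "i < N" "k < K" "square_integrable (P \<mu> \<alpha>) Y"
  shows "covar (P \<mu> \<alpha>) (observation i k) Y = covar (P \<mu> \<alpha>) (Z (Mean i)) Y
    + covar (P \<mu> \<alpha>) (Z (Error i k)) Y + treated i * covar (P \<mu> \<alpha>) (Z (Effect i)) Y"
proof -
  interpret prob_space "P \<mu> \<alpha>" by (rule prob_space_P)
  have *: "square_integrable (P \<mu> \<alpha>) (Z (Mean i))" "square_integrable (P \<mu> \<alpha>) (Z (Error i k))"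
    "square_integrable (P \<mu> \<alpha>) (Z (Effect i))"
    using assms by (auto intro: square_integrable_rv)
  show ?thesis
    unfolding observation_alt using * assms(3)
    by (simp add: covar_add_left covar_cmult_left square_integrable_add square_integrable_cmult)
qed

lemma covar_observation_effect:
  assumes "j < N" "k < K" "i < N"
  shows "covar (P \<mu> \<alpha>) (observation j k) (Z (Effect i))
    = (if j = i then treated i * (v * \<sigma>2) else 0)"
  using assms
  by (auto simp: covar_observation_left square_integrable_rv uncorrelated var_Effect)

lemma covar_observations:
  assumes "i < N" "k < K" "j < N" "l < K"
  shows "covar (P \<mu> \<alpha>) (observation i k) (observation j l)
    = (if i = j then (u + treated i * v) * \<sigma>2 + (if k = l then \<sigma>2 else 0) else 0)"
proof -
  have "covar (P \<mu> \<alpha>) (Z e) (observation j l)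
      = covar (P \<mu> \<alpha>) (Z (Mean j)) (Z e) + covar (P \<mu> \<alpha>) (Z (Error j l)) (Z e)
        + treated j * covar (P \<mu> \<alpha>) (Z (Effect j)) (Z e)" if "e \<in> rv_labels N K" for e
    unfolding covar_commute[of _ "Z e" "observation j l"]
    using assms that by (intro covar_observation_left square_integrable_rv) auto
  then show ?thesis
    using assms
    by (auto simp: covar_observation_left square_integrable_observation uncorrelated
        var_Mean var_Effect var_Error algebra_simps)
qed

lemma covar_prediction_error_left:
  assumes "i < N" and "square_integrable (P \<mu> \<alpha>) Y"
  shows "covar (P \<mu> \<alpha>) (prediction_error c i) Y
    = (\<Sum>j<N. \<Sum>k<K. c i j k * covar (P \<mu> \<alpha>) (observation j k) Y)
      - covar (P \<mu> \<alpha>) (Z (Effect i)) Y"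
proof -
  interpret prob_space "P \<mu> \<alpha>" by (rule prob_space_P)
  have "covar (P \<mu> \<alpha>) (prediction_error c i) Y
      = covar (P \<mu> \<alpha>) (prediction c i) Y - covar (P \<mu> \<alpha>) (Z (Effect i)) Y"
    unfolding prediction_error_def[abs_def] using assms
    by (intro covar_diff_left square_integrable_prediction square_integrable_rv) auto
  also have "covar (P \<mu> \<alpha>) (prediction c i) Y
      = (\<Sum>j<N. covar (P \<mu> \<alpha>) (\<lambda>\<omega>. \<Sum>k<K. c i j k * observation j k \<omega>) Y)"
    unfolding prediction_def[abs_def]
    by (intro covar_sum_left assms(2) square_integrable_sum square_integrable_cmult
        square_integrable_observation) auto
  also have "\<dots> = (\<Sum>j<N. \<Sum>k<K. covar (P \<mu> \<alpha>) (\<lambda>\<omega>. c i j k * observation j k \<omega>) Y)"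
    by (intro sum.cong refl covar_sum_left assms(2) square_integrable_cmult
        square_integrable_observation) auto
  also have "\<dots> = (\<Sum>j<N. \<Sum>k<K. c i j k * covar (P \<mu> \<alpha>) (observation j k) Y)"
    by (intro sum.cong refl covar_cmult_left assms(2) square_integrable_observation) auto
  finally show ?thesis .
qed

end

section \<open>The best linear unbiased predictor\<close>

context two_group_rcr
begin

lemma expectation_observation:
  assumes "j < N" "k < K"
  shows "(\<integral>\<omega>. observation j k \<omega> \<partial>P \<mu> \<alpha>) = \<mu> + treated j * \<alpha>"
proof -
  interpret prob_space "P \<mu> \<alpha>" by (rule prob_space_P)
  show ?thesis
    unfolding observation_alt using assms
    by (simp add: square_integrable_integrable square_integrable_rv
        mean_Mean mean_Effect mean_Error)
qed

lemma expectation_prediction_error: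
  assumes "i < N"
  shows "(\<integral>\<omega>. prediction_error c i \<omega> \<partial>P \<mu> \<alpha>)
    = \<mu> * (\<Sum>j<N. \<Sum>k<K. c i j k) + \<alpha> * (\<Sum>j<n. \<Sum>k<K. c i j k) - \<alpha>"
proof -
  interpret prob_space "P \<mu> \<alpha>" by (rule prob_space_P)
  have int: "integrable (P \<mu> \<alpha>) (observation j k)" if "j < N" "k < K" for j k
    using that by (intro square_integrable_integrable square_integrable_observation)
  have "(\<integral>\<omega>. prediction c i \<omega> \<partial>P \<mu> \<alpha>)
      = (\<Sum>j<N. \<Sum>k<K. c i j k * (\<integral>\<omega>. observation j k \<omega> \<partial>P \<mu> \<alpha>))"
  proof -
    have "(\<integral>\<omega>. prediction c i \<omega> \<partial>P \<mu> \<alpha>)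
        = (\<Sum>j<N. \<integral>\<omega>. (\<Sum>k<K. c i j k * observation j k \<omega>) \<partial>P \<mu> \<alpha>)"
      unfolding prediction_def using int
      by (intro Bochner_Integration.integral_sum integrable_sum integrable_mult_right) auto
    also have "\<dots> = (\<Sum>j<N. \<Sum>k<K. \<integral>\<omega>. c i j k * observation j k \<omega> \<partial>P \<mu> \<alpha>)"
      using int
      by (intro sum.cong refl Bochner_Integration.integral_sum integrable_mult_right) auto
    finally show ?thesis by simp
  qed
  also have "\<dots> = (\<Sum>j<N. \<mu> * (\<Sum>k<K. c i j k) + \<alpha> * (treated j * (\<Sum>k<K. c i j k)))"
    by (intro sum.cong)
       (auto simp: expectation_observation sum_distrib_left sum.distrib algebra_simps)
  also have "\<dots> = \<mu> * (\<Sum>j<N. \<Sum>k<K. c i j k) + \<alpha> * (\<Sum>j<N. treated j * (\<Sum>k<K. c i j k))"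
    by (simp add: sum.distrib sum_distrib_left)
  also have "(\<Sum>j<N. treated j * (\<Sum>k<K. c i j k)) = (\<Sum>j<n. \<Sum>k<K. c i j k)"
  proof -
    have "{..<N} \<inter> {j. j < n} = {..<n}" using sizes by auto
    then show ?thesis by simp
  qed
  finally show ?thesis
    using assms unfolding prediction_error_def
    by (simp add: square_integrable_integrable square_integrable_prediction
        square_integrable_rv mean_Effect)
qed

text \<open>The expected error is an affine function of the two unknown means \<open>\<mu>\<close> and \<open>\<alpha>\<close>; requiring it to
  vanish identically fixes the sums of the coefficients over the two groups.\<close>

lemma unbiased_iff:
  "unbiased c \<longleftrightarrow> (\<forall>i<N. (\<Sum>j<n. \<Sum>k<K. c i j k) = 1 \<and> (\<Sum>j\<in>{n..<N}. \<Sum>k<K. c i j k) = -1)"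
proof -
  have total: "(\<Sum>j<N. \<Sum>k<K. c i j k)
      = (\<Sum>j<n. \<Sum>k<K. c i j k) + (\<Sum>j\<in>{n..<N}. \<Sum>k<K. c i j k)" for i
    using sizes by (intro sum_lessThan_split) simp
  have key: "(\<forall>\<mu> \<alpha>. \<mu> * (S + R) + \<alpha> * S - \<alpha> = 0) \<longleftrightarrow> S = 1 \<and> R = -1" for S R :: real
  proof
    assume *: "\<forall>\<mu> \<alpha>. \<mu> * (S + R) + \<alpha> * S - \<alpha> = 0"
    show "S = 1 \<and> R = -1" using *[rule_format, of 0 1] *[rule_format, of 1 0] by simp
  qed simp
  have "unbiased c \<longleftrightarrow> (\<forall>i<N. \<forall>\<mu> \<alpha>.
      \<mu> * ((\<Sum>j<n. \<Sum>k<K. c i j k) + (\<Sum>j\<in>{n..<N}. \<Sum>k<K. c i j k))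
        + \<alpha> * (\<Sum>j<n. \<Sum>k<K. c i j k) - \<alpha> = 0)"
    (is "_ \<longleftrightarrow> (\<forall>i<N. \<forall>\<mu> \<alpha>. ?bias i \<mu> \<alpha> = 0)")
  proof -
    have bias: "(\<integral>\<omega>. prediction_error c i \<omega> \<partial>P \<mu> \<alpha>) = ?bias i \<mu> \<alpha>" if "i < N" for i \<mu> \<alpha>
      unfolding total[symmetric] by (rule expectation_prediction_error[OF that])
    show ?thesis
    proof (intro iffI allI impI)
      fix i \<mu> \<alpha> assume "unbiased c" "i < N"
      then show "?bias i \<mu> \<alpha> = 0"
        unfolding bias[OF \<open>i < N\<close>, symmetric] unbiased_def by blast
    next
      assume *: "\<forall>i<N. \<forall>\<mu> \<alpha>. ?bias i \<mu> \<alpha> = 0"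
      show "unbiased c"
        unfolding unbiased_def
      proof (intro allI impI)
        fix \<mu> \<alpha> i assume i: "i < N"
        show "(\<integral>\<omega>. prediction_error c i \<omega> \<partial>P \<mu> \<alpha>) = 0"
          unfolding bias[OF i] using * i by blast
      qed
    qed
  qed
  then show ?thesis unfolding key .
qed

text \<open>The ratio of the covariance of an individual effect with the mean observation of the same
  treated individual to the variance of that mean observation.\<close>

definition shrinkage :: real where
  "shrinkage = real K * v / (real K * (u + v) + 1)"

text \<open>The difference of the two group means, which estimates the average effect; for a treated
  individual \<open>i\<close> one adds the deviation of its own mean observation from the mean of its group,
  shrunk by the regression coefficient \<open>shrinkage\<close>.\<close>

definition blup_coeff :: "nat \<Rightarrow> nat \<Rightarrow> nat \<Rightarrow> real" where
  "blup_coeff i j k = (if j < n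
     then 1 / real n + treated i * (shrinkage * (of_bool (i = j) - 1 / real n))
     else - 1 / (real N - real n)) / real K"

lemma unbiased_blup_coeff: "unbiased blup_coeff"
  unfolding unbiased_iff
proof (intro allI impI conjI)
  fix i assume "i < N"
  have K: "(\<Sum>k<K. blup_coeff i j k) = (if j < n
     then 1 / real n + treated i * (shrinkage * (of_bool (i = j) - 1 / real n))
     else - 1 / (real N - real n))" for j
    using sizes by (simp add: blup_coeff_def)
  have pos: "0 < real K" "0 < real n" "0 < real N - real n" using sizes by auto
  have "(\<Sum>j<n. \<Sum>k<K. blup_coeff i j k)
      = (\<Sum>j<n. 1 / real n + (treated i * shrinkage * of_bool (i = j)
           - treated i * shrinkage / real n))"
    unfolding K using pos by (intro sum.cong) (auto simp: algebra_simps)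
  also have "\<dots> = 1"
    unfolding sum.distrib sum_subtractf sum_distrib_left[symmetric] using pos
    by (cases "i < n") (auto simp: of_bool_def)
  finally show "(\<Sum>j<n. \<Sum>k<K. blup_coeff i j k) = 1" .
  have "(\<Sum>j\<in>{n..<N}. \<Sum>k<K. blup_coeff i j k) = (\<Sum>j\<in>{n..<N}. - 1 / (real N - real n))"
    unfolding K by (intro sum.cong) auto
  also have "\<dots> = -1" using pos sizes by (simp add: of_nat_diff)
  finally show "(\<Sum>j\<in>{n..<N}. \<Sum>k<K. blup_coeff i j k) = -1" .
qed

text \<open>The shrinkage factor is chosen such that the covariances of the prediction error for \<open>i\<close> with
  the observations are constant on each group: the contributions of \<open>i\<close>'s own observations through
  the shrunk deviation and through the effect itself cancel.  Constancy makes the error uncorrelated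
  with every linear combination whose coefficients sum to zero in each group, that is, with every
  linear unbiased estimator of zero.\<close>

lemma covar_observation_blup_error:
  assumes "j < N" "k < K" "i < N"
  shows "covar (P \<mu> \<alpha>) (observation j k) (prediction_error blup_coeff i) =
    (if j < n then \<sigma>2 * (real K * (u + v) + 1) / (real K * real n) - treated i * (v * \<sigma>2 / real n)
     else - \<sigma>2 * (real K * u + 1) / (real K * (real N - real n)))"
proof -
  have pos: "0 < real K" "0 < real n" "0 < real N - real n" using sizes by auto
  have a: "0 < real K * (u + v) + 1" using params_pos by (simp add: add_nonneg_pos)
  have "covar (P \<mu> \<alpha>) (prediction_error blup_coeff i) (observation j k)
      = (\<Sum>j'<N. \<Sum>k'<K. blup_coeff i j' k' * covar (P \<mu> \<alpha>) (observation j' k') (observation j k))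
        - covar (P \<mu> \<alpha>) (Z (Effect i)) (observation j k)"
    using assms by (intro covar_prediction_error_left square_integrable_observation) auto
  also have "(\<Sum>j'<N. \<Sum>k'<K.
        blup_coeff i j' k' * covar (P \<mu> \<alpha>) (observation j' k') (observation j k))
      = (\<Sum>j'<N. if j' = j then \<Sum>k'<K. blup_coeff i j k' *
          ((u + treated j * v) * \<sigma>2 + (if k' = k then \<sigma>2 else 0)) else 0)"
    using assms by (intro sum.cong) (auto simp: covar_observations intro!: sum.cong)
  also have "\<dots> = (\<Sum>k'<K. blup_coeff i j k *
          ((u + treated j * v) * \<sigma>2 + (if k' = k then \<sigma>2 else 0)))"
    using assms by (simp add: blup_coeff_def)
  also have "\<dots> = real K * blup_coeff i j k * ((u + treated j * v) * \<sigma>2) + blup_coeff i j k * \<sigma>2"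
    unfolding sum_distrib_left[symmetric] using assms by (simp add: sum.distrib distrib_left)
  also have "\<dots> = blup_coeff i j k * (real K * (u + treated j * v) + 1) * \<sigma>2"
    by (simp add: algebra_simps)
  finally have covar_eq: "covar (P \<mu> \<alpha>) (observation j k) (prediction_error blup_coeff i)
      = blup_coeff i j k * (real K * (u + treated j * v) + 1) * \<sigma>2
        - (if j = i then treated i * (v * \<sigma>2) else 0)"
    using assms covar_observation_effect[of j k i \<mu> \<alpha>]
    by (simp add: covar_commute[of _ "Z (Effect i)"]
        covar_commute[of _ "observation j k" "prediction_error blup_coeff i"])
  have shr: "shrinkage * (real K * (u + v) + 1) = real K * v"
    using a by (simp add: shrinkage_def)
  have "(1 / real n + treated i * (shrinkage * (of_bool (i = j) - 1 / real n))) / real K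
       * (real K * (u + v) + 1) * \<sigma>2
     = \<sigma>2 * (real K * (u + v) + 1) / (real K * real n)
       + treated i * (of_bool (i = j) - 1 / real n) * \<sigma>2
         * (shrinkage * (real K * (u + v) + 1)) / real K"
    using pos by (simp add: field_simps)
  also have "\<dots> = \<sigma>2 * (real K * (u + v) + 1) / (real K * real n)
       + treated i * (of_bool (i = j) - 1 / real n) * \<sigma>2 * v"
    unfolding shr using pos by simp
  finally have treated_eq: "(1 / real n + treated i * (shrinkage * (of_bool (i = j) - 1 / real n))) / real K
       * (real K * (u + v) + 1) * \<sigma>2
     = \<sigma>2 * (real K * (u + v) + 1) / (real K * real n)
       + treated i * (of_bool (i = j) - 1 / real n) * \<sigma>2 * v" .
  show ?thesis
  proof (cases "j < n")
    case True
    have "covar (P \<mu> \<alpha>) (observation j k) (prediction_error blup_coeff i)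
      = (1 / real n + treated i * (shrinkage * (of_bool (i = j) - 1 / real n))) / real K
          * (real K * (u + v) + 1) * \<sigma>2 - (if j = i then treated i * (v * \<sigma>2) else 0)"
      unfolding covar_eq blup_coeff_def using True by simp
    then show ?thesis
      unfolding treated_eq using True by (cases "i = j") (auto simp: algebra_simps)
  next
    case False
    then show ?thesis unfolding covar_eq blup_coeff_def by (simp add: mult.commute)
  qed
qed

lemma covar_effect_blup_error:
  assumes "l < N" "i < N"
  shows "covar (P \<mu> \<alpha>) (Z (Effect l)) (prediction_error blup_coeff i)
    = treated l * (v * \<sigma>2) * (1 / real n + treated i * (shrinkage * (of_bool (i = l) - 1 / real n)))
      - of_bool (i = l) * (v * \<sigma>2)"
proof -
  have "covar (P \<mu> \<alpha>) (prediction_error blup_coeff i) (Z (Effect l))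
      = (\<Sum>j<N. \<Sum>k<K. blup_coeff i j k * covar (P \<mu> \<alpha>) (observation j k) (Z (Effect l)))
        - covar (P \<mu> \<alpha>) (Z (Effect i)) (Z (Effect l))"
    using assms by (intro covar_prediction_error_left square_integrable_rv) auto
  also have "(\<Sum>j<N. \<Sum>k<K. blup_coeff i j k * covar (P \<mu> \<alpha>) (observation j k) (Z (Effect l)))
      = (\<Sum>j<N. if j = l then \<Sum>k<K. blup_coeff i l k * (treated l * (v * \<sigma>2)) else 0)"
    using assms by (intro sum.cong) (auto simp: covar_observation_effect intro!: sum.cong)
  also have "\<dots> = real K * blup_coeff i l 0 * (treated l * (v * \<sigma>2))"
    using assms by (simp add: blup_coeff_def)
  also have "\<dots> = treated l * (v * \<sigma>2)
      * (1 / real n + treated i * (shrinkage * (of_bool (i = l) - 1 / real n)))"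
    using sizes by (simp add: blup_coeff_def)
  also have "covar (P \<mu> \<alpha>) (Z (Effect i)) (Z (Effect l)) = of_bool (i = l) * (v * \<sigma>2)"
    using assms by (auto simp: var_Effect uncorrelated)
  finally show ?thesis by (simp add: covar_commute[of _ "Z (Effect l)"])
qed

definition blup_error_cov :: "real mat" where
  "blup_error_cov = two_block_mat N n ((1 - shrinkage) * (v * \<sigma>2)) (v * \<sigma>2)
     (\<sigma>2 * (real K * u + 1) * real N / (real K * real n * (real N - real n)))"

text \<open>Only the group sums of the coefficients of \<open>d\<close> enter, because the observations of one group have
  the same covariance with the second error, and unbiasedness fixes these sums.  So the result does
  not depend on \<open>d\<close>: for \<open>d = blup_coeff\<close> it is the error covariance matrix itself, and for other
  \<open>d\<close> it is the orthogonality that makes \<open>blup_coeff\<close> optimal.\<close>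

lemma covar_unbiased_error_blup_error:
  assumes "unbiased d" "l < N" "i < N"
  shows "covar (P \<mu> \<alpha>) (prediction_error d l) (prediction_error blup_coeff i)
    = blup_error_cov $$ (l, i)"
proof -
  have pos: "0 < real K" "0 < real n" "0 < real N - real n" using sizes by auto
  define c1 where "c1 = \<sigma>2 * (real K * (u + v) + 1) / (real K * real n)
    - treated i * (v * \<sigma>2 / real n)"
  define c2 where "c2 = \<sigma>2 * (real K * u + 1) / (real K * (real N - real n))"
  let ?cov = "\<lambda>j k. covar (P \<mu> \<alpha>) (observation j k) (prediction_error blup_coeff i)"
  have "(\<Sum>j<N. \<Sum>k<K. d l j k * ?cov j k)
      = (\<Sum>j<n. \<Sum>k<K. d l j k * ?cov j k) + (\<Sum>j\<in>{n..<N}. \<Sum>k<K. d l j k * ?cov j k)"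
    using sizes by (intro sum_lessThan_split) simp
  also have "(\<Sum>j<n. \<Sum>k<K. d l j k * ?cov j k) = (\<Sum>j<n. \<Sum>k<K. d l j k) * c1"
    unfolding sum_distrib_right using assms sizes
    by (intro sum.cong refl) (auto simp: covar_observation_blup_error c1_def)
  also have "(\<Sum>j\<in>{n..<N}. \<Sum>k<K. d l j k * ?cov j k) = (\<Sum>j\<in>{n..<N}. \<Sum>k<K. d l j k) * (- c2)"
    unfolding sum_distrib_right using assms sizes
    by (intro sum.cong refl) (auto simp: covar_observation_blup_error c2_def)
  also have "(\<Sum>j<n. \<Sum>k<K. d l j k) * c1 + (\<Sum>j\<in>{n..<N}. \<Sum>k<K. d l j k) * (- c2) = c1 + c2"
    using assms by (simp add: unbiased_iff)
  also have "\<dots> = v * \<sigma>2 / real n * (1 - treated i)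
      + \<sigma>2 * (real K * u + 1) * real N / (real K * real n * (real N - real n))"
  proof -
    define m where "m = real N - real n"
    have m: "0 < m" and N: "real N = m + real n" using pos by (auto simp: m_def)
    have c1: "c1 = v * \<sigma>2 / real n * (1 - treated i)
        + \<sigma>2 * (real K * u + 1) / (real K * real n)"
      using pos unfolding c1_def by (cases "i < n") (simp_all add: field_simps)
    have "A / (real K * real n) + A / (real K * m)
        = A * (m + real n) / (real K * real n * m)" for A
      using pos m by (simp add: field_simps)
    then show ?thesis
      unfolding c1 c2_def m_def[symmetric] unfolding N by (simp only: add.assoc)
  qed
  finally have sum: "(\<Sum>j<N. \<Sum>k<K. d l j k * ?cov j k) = v * \<sigma>2 / real n * (1 - treated i)
      + \<sigma>2 * (real K * u + 1) * real N / (real K * real n * (real N - real n))" .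
  have "covar (P \<mu> \<alpha>) (prediction_error d l) (prediction_error blup_coeff i)
      = (\<Sum>j<N. \<Sum>k<K. d l j k * ?cov j k)
        - covar (P \<mu> \<alpha>) (Z (Effect l)) (prediction_error blup_coeff i)"
    using assms by (intro covar_prediction_error_left square_integrable_prediction_error)
  moreover define q where "q = v * \<sigma>2"
  moreover define B where
    "B = \<sigma>2 * (real K * u + 1) * real N / (real K * real n * (real N - real n))"
  ultimately have "covar (P \<mu> \<alpha>) (prediction_error d l) (prediction_error blup_coeff i)
      = q / real n * (1 - treated i) + B
        - (treated l * q * (1 / real n + treated i * (shrinkage * (of_bool (i = l) - 1 / real n)))
           - of_bool (i = l) * q)"
    using sum covar_effect_blup_error[OF assms(2,3)] by simp
  also have "\<dots> = B + (if l < n \<and> i < n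
         then (1 - shrinkage) * q * ((if l = i then 1 else 0) - 1 / real n)
       else if n \<le> l \<and> n \<le> i then q * ((if l = i then 1 else 0) + 1 / real n)
       else 0)"
    by (cases "l < n"; cases "i < n"; cases "i = l") (simp_all add: algebra_simps)
  also have "\<dots> = blup_error_cov $$ (l, i)"
    using assms by (simp add: blup_error_cov_def two_block_mat_def q_def B_def)
  finally show ?thesis .
qed

lemma is_BLUP_blup_coeff: "is_BLUP blup_coeff"
  unfolding is_BLUP_def
proof (intro conjI allI impI unbiased_blup_coeff)
  fix d \<mu> \<alpha> assume d: "unbiased d"
  interpret prob_space "P \<mu> \<alpha>" by (rule prob_space_P)
  show "loewner_le N (error_cov blup_coeff \<mu> \<alpha>) (error_cov d \<mu> \<alpha>)"
    unfolding loewner_le_def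
  proof
    fix x :: "real vec" assume x: "x \<in> carrier_vec N"
    define E where "E c \<omega> = (\<Sum>i<N. vec_index x i * prediction_error c i \<omega>)" for c \<omega>
    have sq: "square_integrable (P \<mu> \<alpha>) (E c)" for c
      unfolding E_def[abs_def]
      by (intro square_integrable_sum square_integrable_cmult square_integrable_prediction_error)
         auto
    have covE: "covar (P \<mu> \<alpha>) (E c) (E c')
        = (\<Sum>i<N. vec_index x i * (\<Sum>j<N. vec_index x j *
             covar (P \<mu> \<alpha>) (prediction_error c i) (prediction_error c' j)))" for c c'
      unfolding E_def[abs_def]
      by (intro covar_linear_combinations square_integrable_prediction_error)
    have form: "scalar_prod x (error_cov c \<mu> \<alpha> *\<^sub>v x) = covar (P \<mu> \<alpha>) (E c) (E c)" for c
      unfolding error_cov_def covE using x by (simp add: mat_quadratic_form)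
    have "covar (P \<mu> \<alpha>) (E d) (E blup_coeff) = covar (P \<mu> \<alpha>) (E blup_coeff) (E blup_coeff)"
      unfolding covE
      by (simp add: covar_unbiased_error_blup_error d unbiased_blup_coeff)
    then show "scalar_prod x (error_cov blup_coeff \<mu> \<alpha> *\<^sub>v x)
        \<le> scalar_prod x (error_cov d \<mu> \<alpha> *\<^sub>v x)"
      unfolding form by (intro covar_le_of_uncorrelated_difference sq)
  qed
qed

lemma error_cov_carrier: "error_cov c \<mu> \<alpha> \<in> carrier_mat N N"
  by (simp add: error_cov_def)

lemma error_cov_symmetric:
  "i < N \<Longrightarrow> j < N \<Longrightarrow> error_cov c \<mu> \<alpha> $$ (i, j) = error_cov c \<mu> \<alpha> $$ (j, i)"
  by (simp add: error_cov_def) (rule covar_commute)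

lemma error_cov_BLUP:
  assumes "is_BLUP c"
  shows "error_cov c \<mu> \<alpha> = blup_error_cov"
proof -
  have "error_cov c \<mu> \<alpha> = error_cov blup_coeff \<mu> \<alpha>"
  proof (rule loewner_le_antisym)
    show "loewner_le N (error_cov c \<mu> \<alpha>) (error_cov blup_coeff \<mu> \<alpha>)"
      "loewner_le N (error_cov blup_coeff \<mu> \<alpha>) (error_cov c \<mu> \<alpha>)"
      using assms is_BLUP_blup_coeff by (auto simp: is_BLUP_def)
  qed (simp_all add: error_cov_carrier error_cov_symmetric)
  also have "\<dots> = blup_error_cov"
  proof (rule eq_matI)
    have dim: "dim_row blup_error_cov = N" "dim_col blup_error_cov = N"
      by (simp_all add: blup_error_cov_def two_block_mat_def)
    show "error_cov blup_coeff \<mu> \<alpha> $$ (i, j) = blup_error_cov $$ (i, j)"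
      if "i < dim_row blup_error_cov" "j < dim_col blup_error_cov" for i j
      using that covar_unbiased_error_blup_error[OF unbiased_blup_coeff, of i j \<mu> \<alpha>]
      by (simp add: dim error_cov_def)
    show "dim_row (error_cov blup_coeff \<mu> \<alpha>) = dim_row blup_error_cov"
      "dim_col (error_cov blup_coeff \<mu> \<alpha>) = dim_col blup_error_cov"
      by (simp_all add: dim error_cov_def)
  qed
  finally show ?thesis .
qed

end

section \<open>The optimal weight\<close>

context two_group_rcr
begin

lemma E_criterion_exact_eq:
  "E_criterion_exact \<mu> \<alpha> = E_criterion K \<sigma>2 u v (real n / real N)"
proof -
  define w where "w = real n / real N"
  define B where "B = \<sigma>2 * (real K * u + 1) * real N / (real K * real n * (real N - real n))"
  have pos: "0 < real K" "0 < real n" "0 < real N - real n" "0 < real N" using sizes by auto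
  have w: "0 < w" "w < 1" using pos by (auto simp: w_def)
  have "0 < B" using pos params_pos by (simp add: B_def add_pos_pos)
  have "0 \<le> shrinkage" using params_pos by (simp add: shrinkage_def)
  then have pq: "(1 - shrinkage) * (v * \<sigma>2) \<le> v * \<sigma>2"
    using params_pos mult_right_mono[of "1 - shrinkage" 1 "v * \<sigma>2"] by simp
  have Bw: "B * real N = \<sigma>2 * (real K * u + 1) / (real K * w * (1 - w))"
    unfolding B_def w_def using pos by (simp add: field_simps)
  have nw: "v * \<sigma>2 * real N / real n = \<sigma>2 * (v / w)" by (simp add: w_def)
  have "error_cov (SOME c. is_BLUP c) \<mu> \<alpha> = blup_error_cov"
    using someI[of is_BLUP, OF is_BLUP_blup_coeff] by (rule error_cov_BLUP)
  then have "E_criterion_exact \<mu> \<alpha>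
      = larger_root (B * real N + v * \<sigma>2 * real N / real n) (B * (v * \<sigma>2) * real N)"
    unfolding E_criterion_exact_def blup_error_cov_def B_def[symmetric]
    using sizes params_pos pq \<open>0 < B\<close> by (simp add: largest_eigenvalue_two_block_mat)
  also have "B * real N + v * \<sigma>2 * real N / real n
      = \<sigma>2 * (v / w + (real K * u + 1) / (real K * w * (1 - w)))"
    unfolding Bw nw by (simp add: distrib_left)
  also have "B * (v * \<sigma>2) * real N = \<sigma>2\<^sup>2 * v * (real K * u + 1) / (real K * w * (1 - w))"
  proof -
    have "B * (v * \<sigma>2) * real N = v * \<sigma>2 * (B * real N)" by simp
    then show ?thesis unfolding Bw by (simp add: power2_eq_square mult_ac)
  qed
  also have "larger_root (\<sigma>2 * (v / w + (real K * u + 1) / (real K * w * (1 - w)))) \<dots>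
      = E_criterion K \<sigma>2 u v w"
    using E_criterion_larger_root[of K \<sigma>2 w u v] sizes params_pos w by simp
  finally show ?thesis unfolding w_def .
qed

end

theorem theorem15:
  fixes K :: nat and \<sigma>2 u v :: real
  assumes "1 \<le> K" and "0 < \<sigma>2" and "0 < u" and "0 < v"
  shows
    "(\<forall>(P :: real \<Rightarrow> real \<Rightarrow> 'a measure) Z N n \<mu> \<alpha>.
        two_group_rcr P Z N n K \<sigma>2 u v \<longrightarrow>
          two_group_rcr.E_criterion_exact P Z N n K \<mu> \<alpha>
            = E_criterion K \<sigma>2 u v (real n / real N))
     \<and> (\<forall>w. is_arg_min (E_criterion K \<sigma>2 u v) (\<lambda>w. w \<in> {0<..<1}) w
            \<longleftrightarrow> w = (real K * (2 * u + v) + 2) / (real K * (4 * u + v) + 4))"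
  using E_criterion_arg_min[OF assms] by (auto intro: two_group_rcr.E_criterion_exact_eq)

end
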